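(* Every instance of the axiom schemes (A0)–(A9) of $\Sigma$ is valid over the class of normal jstit models (true at every moment-history pair of every normal jstit model), and every application of any of the rules (R1)–(R4) to formulas valid over the class of normal jstit models yields a formula valid over the class of normal jstit models.
   Context: Fix a finite nonempty set $Ag$ of agents and countably infinite, pairwise disjoint sets $PVar$ (proof variables), $PConst$ (proof constants) and $Var$ (propositional variables). Proof polynomials: $t ::= x \mid c \mid s+t \mid s\times t \mid\ !t$; their set is $Pol$. Formulas: $A ::= p \mid A\wedge B \mid \neg A \mid [j]A \mid \Box A \mid t{:}A \mid KA \mid Et$ ($p\in Var$, $j\in Ag$, $t\in Pol$); their set is $Form$; $\Diamond=\neg\Box\neg$. A jstit model is $\mathcal{M}=\langle Tree,\unlhd,Choice,Act,R,R_e,\mathcal{E},V\rangle$ where $Tree\neq\emptyset$; $\unlhd$ is a partial order on $Tree$ ($\lhd$ its strict part); histories are maximal $\unlhd$-chains, $H_m$ the histories containing $m$, $MH=\{(m,h): h\in H_m\}$; $Choice^m_j$ ($j\in Ag$) is a partition of $H_m$, $Choice^m_j(h)$ the cell of $h$; $Act: MH\to 2^{Pol}$; $R\subseteq R_e$ are preorders on $Tree$; $\mathcal{E}:Tree\times Pol\to 2^{Form}$; $V:Var\to 2^{MH}$. Constraints: (1) any two moments have a common $\unlhd$-lower bound; (2) $m_1\unlhd m$, $m_2\unlhd m$ imply $m_1\unlhd m_2$ or $m_2\unlhd m_1$; (3) if $h,h'\in H_m$ and some $m'\rhd m$ lies in $h\cap h'$ then $Choice^m_j(h)=Choice^m_j(h')$;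 (4) for every $m$ and cells $f(j)\in Choice^m_j$, $\bigcap_j f(j)\neq\emptyset$; (5) $R_e(m,m')$ implies $\mathcal{E}(m,t)\subseteq\mathcal{E}(m',t)$; (6) $A\to B\in\mathcal{E}(m,s)$, $A\in\mathcal{E}(m,t)$ imply $B\in\mathcal{E}(m,s\times t)$; $\mathcal{E}(m,s)\cup\mathcal{E}(m,t)\subseteq\mathcal{E}(m,s+t)$; $A\in\mathcal{E}(m,t)$ implies $t{:}A\in\mathcal{E}(m,!t)$; (7) $m'\lhd m$, $h\in H_m$ imply $Act(m',h)\subseteq Act(m,h)$; (8) $\bigcap_{h\in H_m}Act(m,h)\subseteq\bigcup_{m'\lhd m,\,h\in H_m}Act(m',h)$; (9) if $h,h'\in H_m$ and some $m'\rhd m$ lies in $h\cap h'$ then $Act(m,h)=Act(m,h')$; (10) $\unlhd\subseteq R$; (11) $R_e(m,m')$ implies $\bigcap_{h\in H_m}Act(m,h)\subseteq\bigcap_{h'\in H_{m'}}Act(m',h')$. Truth at $(m,h)$: $p$ iff $(m,h)\in V(p)$; Booleans standard; $[j]A$ iff $A$ at $(m,h')$ for all $h'\in Choice^m_j(h)$; $\Box A$ iff $A$ at $(m,h')$ for all $h'\in H_m$; $KA$ iff $A$ at all $(m',h')$ with $R(m,m')$, $h'\in H_{m'}$; $t{:}A$ iff $A\in\mathcal{E}(m,t)$ and $A$ at all $(m',h')$ with $R_e(m,m')$, $h'\in H_{m'}$; $Et$ iff $t\in Act(m,h)$. A jstit model is normal if for every $c\in PConst$ and $m\in Tree$, every instance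 of (A0)–(A9) belongs to $\mathcal{E}(m,c)$. Axiom schemes: (A0) propositional tautologies; (A1) S5 axioms for $\Box$ and each $[j]$; (A2) $\Box A\to[j]A$; (A3) $(\Diamond[j_1]A_1\wedge\dots\wedge\Diamond[j_n]A_n)\to\Diamond([j_1]A_1\wedge\dots\wedge[j_n]A_n)$, $j_i$ pairwise distinct; (A4) $s{:}(A\to B)\to(t{:}A\to(s\times t){:}B)$; (A5) $t{:}A\to(!t{:}(t{:}A)\wedge KA)$; (A6) $(s{:}A\vee t{:}A)\to(s+t){:}A$; (A7) S4 axioms for $K$; (A8) $KA\to\Box K\Box A$; (A9) $\Box Et\to K\Box Et$. Rules: (R1) from $A$ and $A\to B$ infer $B$; (R2) from $A$ infer $KA$; (R3) if $A$ is an instance of (A0)–(A9) and $c\in PConst$, infer $c{:}A$; (R4) from $KA\to(\neg\Box Et_1\vee\dots\vee\neg\Box Et_n)$ infer $KA\to(\neg Et_1\vee\dots\vee\neg Et_n)$. *)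

theory Defs
  imports "HOL-Library.Disjoint_Sets"
begin

datatype pol =
    PVar nat
  | PConst nat
  | Sum pol pol
  | App pol pol
  | Bang pol

datatype 'ag form =
    Atom nat
  | Conj "'ag form" "'ag form" (infixr \<open>\<^bold>\<and>\<close> 40)
  | Neg "'ag form" (\<open>\<^bold>\<not> _\<close> [50] 50)
  | Stit 'ag "'ag form"
  | Box "'ag form"
  | Just pol "'ag form"
  | Know "'ag form"
  | Proven pol

text \<open>Implication and disjunction are not primitive. The choice matters to the evidence
  function, which is sensitive to syntactic identity.\<close>

abbreviation Imp :: "'ag form \<Rightarrow> 'ag form \<Rightarrow> 'ag form" (infixr \<open>\<^bold>\<longrightarrow>\<close> 25)
  where "A \<^bold>\<longrightarrow> B \<equiv> \<^bold>\<not> (A \<^bold>\<and> \<^bold>\<not> B)"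

abbreviation Disj :: "'ag form \<Rightarrow> 'ag form \<Rightarrow> 'ag form" (infixr \<open>\<^bold>\<or>\<close> 35)
  where "A \<^bold>\<or> B \<equiv> \<^bold>\<not> (\<^bold>\<not> A \<^bold>\<and> \<^bold>\<not> B)"

abbreviation Dia :: "'ag form \<Rightarrow> 'ag form"
  where "Dia A \<equiv> \<^bold>\<not> Box (\<^bold>\<not> A)"

text \<open>Iterated connectives associate to the left and are meant for nonempty lists only.\<close>

definition Conjs :: "'ag form list \<Rightarrow> 'ag form"
  where "Conjs As = foldl (\<lambda>A B. A \<^bold>\<and> B) (hd As) (tl As)"

definition Disjs :: "'ag form list \<Rightarrow> 'ag form"
  where "Disjs As = foldl (\<lambda>A B. A \<^bold>\<or> B) (hd As) (tl As)"

text \<open>Histories are sets of moments. Only the values of \<open>Act\<close>, \<open>Choice\<close> and \<open>Evid\<close> at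
  moments in \<open>Tree\<close> and at histories through them are relevant.\<close>

record ('m, 'ag) jstit =
  Tree :: "'m set"
  le :: "'m rel"
  Choice :: "'m \<Rightarrow> 'ag \<Rightarrow> 'm set set set"
  Act :: "'m \<Rightarrow> 'm set \<Rightarrow> pol set"
  R :: "'m rel"
  Re :: "'m rel"
  Evid :: "'m \<Rightarrow> pol \<Rightarrow> 'ag form set"
  Val :: "nat \<Rightarrow> ('m \<times> 'm set) set"

definition lt :: "('m, 'ag) jstit \<Rightarrow> 'm rel"
  where "lt M = le M - Id"

definition histories :: "('m, 'ag) jstit \<Rightarrow> 'm set set"
  where "histories M = {h. pred_on.maxchain (Tree M) (\<lambda>x y. (x, y) \<in> le M) h}"

definition H :: "('m, 'ag) jstit \<Rightarrow> 'm \<Rightarrow> 'm set set"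
  where "H M m = {h \<in> histories M. m \<in> h}"

definition MH :: "('m, 'ag) jstit \<Rightarrow> ('m \<times> 'm set) set"
  where "MH M = {(m, h). m \<in> Tree M \<and> h \<in> H M m}"

definition cell :: "('m, 'ag) jstit \<Rightarrow> 'm \<Rightarrow> 'ag \<Rightarrow> 'm set \<Rightarrow> 'm set set"
  where "cell M m j h = (THE c. c \<in> Choice M m j \<and> h \<in> c)"

locale jstit_model =
  fixes M :: "('m, 'ag :: finite) jstit"
  assumes Tree_nonempty: "Tree M \<noteq> {}"
    and le_order: "partial_order_on (Tree M) (le M)"
    and Choice_partition: "\<And>m j. m \<in> Tree M \<Longrightarrow> partition_on (H M m) (Choice M m j)"
    and R_preorder: "preorder_on (Tree M) (R M)"
    and Re_preorder: "preorder_on (Tree M) (Re M)"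
    and R_subset_Re: "R M \<subseteq> Re M"
    and Val_MH: "\<And>p. Val M p \<subseteq> MH M"
    and historical_connection:
      "\<And>m m'. m \<in> Tree M \<Longrightarrow> m' \<in> Tree M \<Longrightarrow> \<exists>l \<in> Tree M. (l, m) \<in> le M \<and> (l, m') \<in> le M"
    and no_backward_branching:
      "\<And>m m1 m2. (m1, m) \<in> le M \<Longrightarrow> (m2, m) \<in> le M \<Longrightarrow> (m1, m2) \<in> le M \<or> (m2, m1) \<in> le M"
    and no_choice_between_undivided:
      "\<And>m m' h h' j. m \<in> Tree M \<Longrightarrow> h \<in> H M m \<Longrightarrow> h' \<in> H M m \<Longrightarrow> (m, m') \<in> lt M \<Longrightarrow>
         m' \<in> h \<inter> h' \<Longrightarrow> cell M m j h = cell M m j h'"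
    and independence_of_agents:
      "\<And>m f. m \<in> Tree M \<Longrightarrow> (\<And>j. f j \<in> Choice M m j) \<Longrightarrow> (\<Inter>j. f j) \<noteq> {}"
    and evidence_monotone:
      "\<And>m m' t. (m, m') \<in> Re M \<Longrightarrow> Evid M m t \<subseteq> Evid M m' t"
    and evidence_App:
      "\<And>m s t A B. m \<in> Tree M \<Longrightarrow> (A \<^bold>\<longrightarrow> B) \<in> Evid M m s \<Longrightarrow> A \<in> Evid M m t \<Longrightarrow>
         B \<in> Evid M m (App s t)"
    and evidence_Sum:
      "\<And>m s t. m \<in> Tree M \<Longrightarrow> Evid M m s \<union> Evid M m t \<subseteq> Evid M m (Sum s t)"
    and evidence_Bang:
      "\<And>m t A. m \<in> Tree M \<Longrightarrow> A \<in> Evid M m t \<Longrightarrow> Just t A \<in> Evid M m (Bang t)"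
    and expansion_of_presented_proofs:
      "\<And>m m' h. (m', m) \<in> lt M \<Longrightarrow> h \<in> H M m \<Longrightarrow> Act M m' h \<subseteq> Act M m h"
    and no_new_proofs_guaranteed:
      "\<And>m. m \<in> Tree M \<Longrightarrow>
         (\<Inter>h \<in> H M m. Act M m h) \<subseteq> (\<Union>m' \<in> {m'. (m', m) \<in> lt M}. \<Union>h \<in> H M m. Act M m' h)"
    and presenting_a_new_proof_makes_histories_divide:
      "\<And>m m' h h'. m \<in> Tree M \<Longrightarrow> h \<in> H M m \<Longrightarrow> h' \<in> H M m \<Longrightarrow> (m, m') \<in> lt M \<Longrightarrow>
         m' \<in> h \<inter> h' \<Longrightarrow> Act M m h = Act M m h'"
    and future_always_matters: "le M \<subseteq> R M"
    and presented_proofs_epistemically_transparent: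
      "\<And>m m'. (m, m') \<in> Re M \<Longrightarrow>
         (\<Inter>h \<in> H M m. Act M m h) \<subseteq> (\<Inter>h' \<in> H M m'. Act M m' h')"

primrec holds :: "('m, 'ag) jstit \<Rightarrow> 'm \<Rightarrow> 'm set \<Rightarrow> 'ag form \<Rightarrow> bool" where
  "holds M m h (Atom p) \<longleftrightarrow> (m, h) \<in> Val M p"
| "holds M m h (A \<^bold>\<and> B) \<longleftrightarrow> holds M m h A \<and> holds M m h B"
| "holds M m h (\<^bold>\<not> A) \<longleftrightarrow> \<not> holds M m h A"
| "holds M m h (Stit j A) \<longleftrightarrow> (\<forall>h' \<in> cell M m j h. holds M m h' A)"
| "holds M m h (Box A) \<longleftrightarrow> (\<forall>h' \<in> H M m. holds M m h' A)"
| "holds M m h (Just t A) \<longleftrightarrow>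
     A \<in> Evid M m t \<and> (\<forall>m'. (m, m') \<in> Re M \<longrightarrow> (\<forall>h' \<in> H M m'. holds M m' h' A))"
| "holds M m h (Know A) \<longleftrightarrow> (\<forall>m'. (m, m') \<in> R M \<longrightarrow> (\<forall>h' \<in> H M m'. holds M m' h' A))"
| "holds M m h (Proven t) \<longleftrightarrow> t \<in> Act M m h"

text \<open>Formulas not of the form \<open>A \<^bold>\<and> B\<close> or \<open>\<^bold>\<not> A\<close> are treated as propositional letters, so
  that the tautologies are exactly the substitution instances of propositional tautologies.\<close>

fun prop_eval :: "('ag form \<Rightarrow> bool) \<Rightarrow> 'ag form \<Rightarrow> bool" where
  "prop_eval v (A \<^bold>\<and> B) \<longleftrightarrow> prop_eval v A \<and> prop_eval v B"
| "prop_eval v (\<^bold>\<not> A) \<longleftrightarrow> \<not> prop_eval v A"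
| "prop_eval v A \<longleftrightarrow> v A"

definition tautology :: "'ag form \<Rightarrow> bool"
  where "tautology A \<longleftrightarrow> (\<forall>v. prop_eval v A)"

inductive S4_axiom :: "('ag form \<Rightarrow> 'ag form) \<Rightarrow> 'ag form \<Rightarrow> bool" for b where
  S4_K: "S4_axiom b (b (A \<^bold>\<longrightarrow> B) \<^bold>\<longrightarrow> (b A \<^bold>\<longrightarrow> b B))"
| S4_T: "S4_axiom b (b A \<^bold>\<longrightarrow> A)"
| S4_4: "S4_axiom b (b A \<^bold>\<longrightarrow> b (b A))"

inductive S5_axiom :: "('ag form \<Rightarrow> 'ag form) \<Rightarrow> 'ag form \<Rightarrow> bool" for b where
  S5_S4: "S4_axiom b A \<Longrightarrow> S5_axiom b A"
| S5_5: "S5_axiom b (\<^bold>\<not> b (\<^bold>\<not> A) \<^bold>\<longrightarrow> b (\<^bold>\<not> b (\<^bold>\<not> A)))"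

inductive axiom_inst :: "'ag form \<Rightarrow> bool" where
  A0: "tautology A \<Longrightarrow> axiom_inst A"
| A1_Box: "S5_axiom Box A \<Longrightarrow> axiom_inst A"
| A1_Stit: "S5_axiom (Stit j) A \<Longrightarrow> axiom_inst A"
| A2: "axiom_inst (Box A \<^bold>\<longrightarrow> Stit j A)"
| A3: "jAs \<noteq> [] \<Longrightarrow> distinct (map fst jAs) \<Longrightarrow>
     axiom_inst (Conjs (map (\<lambda>(j, A). Dia (Stit j A)) jAs) \<^bold>\<longrightarrow>
                 Dia (Conjs (map (\<lambda>(j, A). Stit j A) jAs)))"
| A4: "axiom_inst (Just s (A \<^bold>\<longrightarrow> B) \<^bold>\<longrightarrow> (Just t A \<^bold>\<longrightarrow> Just (App s t) B))"
| A5: "axiom_inst (Just t A \<^bold>\<longrightarrow> (Just (Bang t) (Just t A) \<^bold>\<and> Know A))"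
| A6: "axiom_inst ((Just s A \<^bold>\<or> Just t A) \<^bold>\<longrightarrow> Just (Sum s t) A)"
| A7: "S4_axiom Know A \<Longrightarrow> axiom_inst A"
| A8: "axiom_inst (Know A \<^bold>\<longrightarrow> Box (Know (Box A)))"
| A9: "axiom_inst (Box (Proven t) \<^bold>\<longrightarrow> Know (Box (Proven t)))"

text \<open>\<open>rule_app As B\<close>: one application of a rule takes the premises \<open>As\<close> to \<open>B\<close>.\<close>

inductive rule_app :: "'ag form list \<Rightarrow> 'ag form \<Rightarrow> bool" where
  R1: "rule_app [A, A \<^bold>\<longrightarrow> B] B"
| R2: "rule_app [A] (Know A)"
| R3: "axiom_inst A \<Longrightarrow> rule_app [] (Just (PConst c) A)"
| R4: "ts \<noteq> [] \<Longrightarrow>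
     rule_app [Know A \<^bold>\<longrightarrow> Disjs (map (\<lambda>t. \<^bold>\<not> Box (Proven t)) ts)]
              (Know A \<^bold>\<longrightarrow> Disjs (map (\<lambda>t. \<^bold>\<not> Proven t) ts))"

locale normal_jstit_model = jstit_model +
  assumes normal: "\<And>c m A. m \<in> Tree M \<Longrightarrow> axiom_inst A \<Longrightarrow> A \<in> Evid M m (PConst c)"

text \<open>The type \<open>'m\<close> bounds the size of the models considered; results are to be stated for
  arbitrary \<open>'m\<close>.\<close>

definition valid :: "'m itself \<Rightarrow> 'ag :: finite form \<Rightarrow> bool" where
  "valid TYPE('m) A \<longleftrightarrow>
     (\<forall>M :: ('m, 'ag) jstit. normal_jstit_model M \<longrightarrow> (\<forall>(m, h) \<in> MH M. holds M m h A))"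

end

theory Submission
  imports Defs
begin

text \<open>Everything is a direct computation with the truth clauses, except for (R4). Suppose
  \<open>K A\<close> and \<open>E t\<^sub>1, \<dots>, E t\<^sub>n\<close> hold at \<open>(m, h)\<close>. If \<open>h\<close> continues beyond \<open>m\<close>, to
  \<open>m'\<close> say, then all histories through \<open>m'\<close> are undivided at \<open>m\<close>, so they present the same proofs
  at \<open>m\<close>, and still present them at \<open>m'\<close>; hence \<open>\<box> E t\<^sub>i\<close> and \<open>K A\<close> hold at \<open>m'\<close>.
  Otherwise \<open>h\<close> is the only history through \<open>m\<close>, and \<open>\<box> E t\<^sub>i\<close> holds at \<open>m\<close> itself.\<close>

section \<open>Truth of the derived connectives and of tautologies\<close>

lemma holds_Imp: "holds M m h (A \<^bold>\<longrightarrow> B) \<longleftrightarrow> (holds M m h A \<longrightarrow> holds M m h B)"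
  by simp

lemma holds_Conjs:
  assumes "As \<noteq> []"
  shows "holds M m h (Conjs As) \<longleftrightarrow> (\<forall>A \<in> set As. holds M m h A)"
proof -
  have "holds M m h (foldl (\<lambda>A B. A \<^bold>\<and> B) A As) \<longleftrightarrow> holds M m h A \<and> (\<forall>B \<in> set As. holds M m h B)"
    for A As by (induction As arbitrary: A) auto
  with assms show ?thesis
    by (cases As) (auto simp: Conjs_def)
qed

lemma holds_Disjs:
  assumes "As \<noteq> []"
  shows "holds M m h (Disjs As) \<longleftrightarrow> (\<exists>A \<in> set As. holds M m h A)"
proof -
  have "holds M m h (foldl (\<lambda>A B. A \<^bold>\<or> B) A As) \<longleftrightarrow> holds M m h A \<or> (\<exists>B \<in> set As. holds M m h B)"
    for A As by (induction As arbitrary: A) auto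
  with assms show ?thesis
    by (cases As) (auto simp: Disjs_def)
qed

text \<open>Truth at a fixed pair \<open>(m, h)\<close> commutes with conjunction and negation, so
  it is one of the valuations over which \<open>tautology\<close> quantifies.\<close>

lemma prop_eval_holds: "prop_eval (holds M m h) A \<longleftrightarrow> holds M m h A"
  by (induction A) auto

lemma tautology_holds: "tautology A \<Longrightarrow> holds M m h A"
  by (metis tautology_def prop_eval_holds)

context jstit_model
begin

lemma R_in_Tree: "(m, m') \<in> R M \<Longrightarrow> m \<in> Tree M \<and> m' \<in> Tree M"
  using R_preorder by (auto simp: preorder_on_def)

lemma Re_in_Tree: "(m, m') \<in> Re M \<Longrightarrow> m \<in> Tree M \<and> m' \<in> Tree M"
  using Re_preorder by (auto simp: preorder_on_def)

lemma R_refl: "m \<in> Tree M \<Longrightarrow> (m, m) \<in> R M"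
  using R_preorder by (auto simp: preorder_on_def refl_on_def)

lemma R_trans: "(m, m') \<in> R M \<Longrightarrow> (m', m'') \<in> R M \<Longrightarrow> (m, m'') \<in> R M"
  using R_preorder by (auto simp: preorder_on_def dest: transD)

lemma Re_trans: "(m, m') \<in> Re M \<Longrightarrow> (m', m'') \<in> Re M \<Longrightarrow> (m, m'') \<in> Re M"
  using Re_preorder by (auto simp: preorder_on_def dest: transD)

lemma le_refl: "m \<in> Tree M \<Longrightarrow> (m, m) \<in> le M"
  using le_order by (auto simp: partial_order_on_def preorder_on_def refl_on_def)

lemma le_trans: "(m, m') \<in> le M \<Longrightarrow> (m', m'') \<in> le M \<Longrightarrow> (m, m'') \<in> le M"
  using le_order by (auto simp: partial_order_on_def preorder_on_def dest: transD)

lemma le_in_Tree: "(m, m') \<in> le M \<Longrightarrow> m \<in> Tree M \<and> m' \<in> Tree M"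
  using future_always_matters R_in_Tree by blast

section \<open>Choice cells as equivalence classes\<close>

lemma cell_eqI:
  assumes "m \<in> Tree M" "c \<in> Choice M m j" "h \<in> c"
  shows "cell M m j h = c"
  unfolding cell_def
proof (rule the_equality)
  show "d = c" if "d \<in> Choice M m j \<and> h \<in> d" for d
    using that assms Choice_partition[OF assms(1), of j]
    by (auto simp: partition_on_def disjoint_def)
qed (use assms in simp)

lemma cell_in_Choice:
  assumes "m \<in> Tree M" "h \<in> H M m"
  shows "cell M m j h \<in> Choice M m j \<and> h \<in> cell M m j h"
proof -
  obtain c where "c \<in> Choice M m j" "h \<in> c"
    using Choice_partition[OF assms(1), of j] assms(2) by (auto simp: partition_on_def)
  then show ?thesis
    using cell_eqI[OF assms(1)] by metis
qed

lemma Choice_subset_H: "m \<in> Tree M \<Longrightarrow> c \<in> Choice M m j \<Longrightarrow> c \<subseteq> H M m"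
  using Choice_partition[of m j] by (auto simp: partition_on_def)

lemma cell_subset_H: "m \<in> Tree M \<Longrightarrow> h \<in> H M m \<Longrightarrow> cell M m j h \<subseteq> H M m"
  using cell_in_Choice Choice_subset_H by blast

text \<open>This is what makes each \<open>Stit j\<close> an S5 modality: together with
  \<open>h\<close> lying in its own cell, it turns sharing a cell into an equivalence relation on
  \<open>H M m\<close>.\<close>

lemma cell_cong:
  "m \<in> Tree M \<Longrightarrow> h \<in> H M m \<Longrightarrow> h' \<in> cell M m j h \<Longrightarrow> cell M m j h' = cell M m j h"
  using cell_in_Choice cell_eqI by blast

section \<open>Histories as maximal chains\<close>

lemma history_chain:
  assumes "h \<in> histories M"
  shows "h \<subseteq> Tree M" and "\<And>x y. x \<in> h \<Longrightarrow> y \<in> h \<Longrightarrow> (x, y) \<in> le M \<or> (y, x) \<in> le M"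
proof -
  have chain: "pred_on.chain (Tree M) (\<lambda>x y. (x, y) \<in> le M) h"
    using assms by (auto simp: histories_def pred_on.maxchain_def)
  then show "h \<subseteq> Tree M"
    by (auto simp: pred_on.chain_def)
  with chain show "\<And>x y. x \<in> h \<Longrightarrow> y \<in> h \<Longrightarrow> (x, y) \<in> le M \<or> (y, x) \<in> le M"
    using le_refl by (auto simp: pred_on.chain_def)
qed

lemma history_maximal:
  assumes "h \<in> histories M" "h \<subseteq> c" "c \<subseteq> Tree M"
    and "\<And>x y. x \<in> c \<Longrightarrow> y \<in> c \<Longrightarrow> (x, y) \<in> le M \<or> (y, x) \<in> le M"
  shows "c = h"
proof -
  have "pred_on.chain (Tree M) (\<lambda>x y. (x, y) \<in> le M) c"
    using assms(3,4) by (auto simp: pred_on.chain_def)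
  with assms(1,2) show ?thesis
    by (auto simp: histories_def pred_on.maxchain_def)
qed

text \<open>Any \<open>y\<close> in \<open>h\<close> is comparable with \<open>m\<close>. If
  \<open>y\<close> is below \<open>m\<close>, then \<open>x\<close> and \<open>y\<close> share the
  upper bound \<open>m\<close> and are comparable since there is no backward branching; if
  \<open>y\<close> is above \<open>m\<close>, transitivity puts \<open>x\<close> below
  \<open>y\<close>. Hence \<open>insert x h\<close> is still a chain, and maximality
  applies.\<close>

lemma history_downward_closed:
  assumes h: "h \<in> H M m" and x: "(x, m) \<in> le M"
  shows "x \<in> h"
proof -
  have hist: "h \<in> histories M" and m: "m \<in> h"
    using h by (auto simp: H_def)
  have comp: "(x, y) \<in> le M \<or> (y, x) \<in> le M" if "y \<in> h" for y
    using history_chain(2)[OF hist that m] x no_backward_branching le_trans by blast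
  have "insert x h = h"
  proof (rule history_maximal[OF hist])
    show "insert x h \<subseteq> Tree M"
      using history_chain(1)[OF hist] le_in_Tree[OF x] by simp
    show "(a, b) \<in> le M \<or> (b, a) \<in> le M" if "a \<in> insert x h" "b \<in> insert x h" for a b
      using that comp history_chain(2)[OF hist] le_refl le_in_Tree[OF x] by auto
  qed blast
  then show ?thesis by blast
qed

text \<open>Here \<open>m\<close> is the greatest element of \<open>h\<close>, so by downward
  closure every history through \<open>m\<close> contains \<open>h\<close>, and maximality of
  \<open>h\<close> forces equality.\<close>

lemma history_ends_unique:
  assumes h: "h \<in> H M m" and h': "h' \<in> H M m"
    and last: "\<And>m'. m' \<in> h \<Longrightarrow> (m, m') \<notin> lt M"
  shows "h' = h"
proof (rule history_maximal)
  show hist: "h \<in> histories M"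
    using h by (simp add: H_def)
  have "(x, m) \<in> le M" if "x \<in> h" for x
    using history_chain(2)[OF hist that, of m] last[OF that] h le_refl history_chain(1)[OF hist]
    by (auto simp: lt_def H_def)
  then show "h \<subseteq> h'"
    using history_downward_closed[OF h'] by blast
  have hist': "h' \<in> histories M"
    using h' by (simp add: H_def)
  show "h' \<subseteq> Tree M" "\<And>x y. x \<in> h' \<Longrightarrow> y \<in> h' \<Longrightarrow> (x, y) \<in> le M \<or> (y, x) \<in> le M"
    using history_chain[OF hist'] by auto
qed

text \<open>The conclusion speaks of \<open>R\<close> rather than \<open>lt\<close> so that one
  statement covers both cases: a later moment on \<open>h\<close>, or \<open>m\<close> itself when
  \<open>h\<close> ends there. Accessibility by \<open>R\<close> is also what transports knowledge
  from \<open>m\<close> to \<open>m'\<close>.\<close>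

lemma proven_becomes_settled:
  assumes m: "m \<in> Tree M" and h: "h \<in> H M m"
  obtains m' where "(m, m') \<in> R M" "h \<in> H M m'" "\<And>h'. h' \<in> H M m' \<Longrightarrow> Act M m h \<subseteq> Act M m' h'"
proof (cases "\<exists>m' \<in> h. (m, m') \<in> lt M")
  case True
  then obtain m' where m': "m' \<in> h" "(m, m') \<in> lt M" by blast
  then have le: "(m, m') \<in> le M"
    by (simp add: lt_def)
  show ?thesis
  proof (rule that)
    show "(m, m') \<in> R M"
      using le future_always_matters by blast
    show "h \<in> H M m'"
      using h m' by (auto simp: H_def)
    fix h' assume h': "h' \<in> H M m'"
    then have "h' \<in> H M m" "m' \<in> h'"
      using history_downward_closed[OF h' le] by (auto simp: H_def)
    then have "Act M m h = Act M m h'"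
      using presenting_a_new_proof_makes_histories_divide[OF m h _ m'(2)] m'(1) by blast
    with expansion_of_presented_proofs[OF m'(2) h'] show "Act M m h \<subseteq> Act M m' h'"
      by simp
  qed
next
  case False
  then show ?thesis
    using that[OF R_refl[OF m] h] history_ends_unique[OF h] by blast
qed

section \<open>Truth of the axiom schemes\<close>

lemma S4_axiom_Know_holds:
  assumes "S4_axiom Know A" "m \<in> Tree M" "h \<in> H M m"
  shows "holds M m h A"
  using assms by (cases rule: S4_axiom.cases) (use R_refl R_trans in \<open>simp; blast\<close>)+

lemma S5_axiom_Box_holds:
  assumes "S5_axiom Box A" "h \<in> H M m"
  shows "holds M m h A"
  using assms(1)
proof cases
  case S5_S4
  then show ?thesis
    by (cases rule: S4_axiom.cases) (use assms(2) in auto)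
qed (use assms(2) in auto)

lemma S5_axiom_Stit_holds:
  assumes "S5_axiom (Stit j) A" and m: "m \<in> Tree M" and h: "h \<in> H M m"
  shows "holds M m h A"
proof -
  have refl: "h \<in> cell M m j h"
    using cell_in_Choice[OF m h] by blast
  note cong = cell_cong[OF m h]
  from assms(1) show ?thesis
  proof cases
    case S5_S4
    then show ?thesis
    proof cases
      case (S4_T B)
      then show ?thesis using refl by auto
    next
      case (S4_4 B)
      then show ?thesis using cong by auto
    qed auto
  next
    case (S5_5 B)
    then show ?thesis using cong by auto
  qed
qed

text \<open>Independence of agents needs a cell for every agent, while the list names only some; a
  cell is therefore chosen for each agent, and a history common to all of them is the required
  witness.\<close>

lemma independence_holds:
  assumes ne: "jAs \<noteq> []" and dist: "distinct (map fst jAs)"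
    and m: "m \<in> Tree M" and h: "h \<in> H M m"
  shows "holds M m h (Conjs (map (\<lambda>(j, A). Dia (Stit j A)) jAs) \<^bold>\<longrightarrow>
                      Dia (Conjs (map (\<lambda>(j, A). Stit j A) jAs)))"
proof -
  have "\<exists>h' \<in> H M m. \<forall>(j, A) \<in> set jAs. holds M m h' (Stit j A)"
    if prem: "\<forall>(j, A) \<in> set jAs. holds M m h (Dia (Stit j A))"
  proof -
    have "\<exists>c. c \<in> Choice M m j \<and> (\<forall>A. (j, A) \<in> set jAs \<longrightarrow> (\<forall>h' \<in> c. holds M m h' A))" for j
    proof (cases "j \<in> fst ` set jAs")
      case True
      then obtain A where A: "(j, A) \<in> set jAs" by auto
      then obtain h1 where "h1 \<in> H M m" "\<forall>h' \<in> cell M m j h1. holds M m h' A"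
        using prem by fastforce
      \<comment> \<open>Distinct agents mean a single formula per agent, so the cell of
        \<open>h1\<close> meets every demand made on \<open>j\<close>.\<close>
      moreover have "B = A" if "(j, B) \<in> set jAs" for B
        using eq_key_imp_eq_value[OF dist] A that by blast
      ultimately show ?thesis
        using cell_in_Choice[OF m] by blast
    next
      case False
      \<comment> \<open>No formula is demanded of \<open>j\<close>; the cell of \<open>h\<close>
        only serves to show that some cell exists.\<close>
      then show ?thesis
        using cell_in_Choice[OF m h, of j] by force
    qed
    then obtain f where f: "\<And>j. f j \<in> Choice M m j"
      and fA: "\<And>j A h'. (j, A) \<in> set jAs \<Longrightarrow> h' \<in> f j \<Longrightarrow> holds M m h' A"
      by metis
    obtain h' where h': "\<And>j. h' \<in> f j"
      using independence_of_agents[OF m f] by auto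
    have "holds M m h' (Stit j A)" if "(j, A) \<in> set jAs" for j A
      \<comment> \<open>Since \<open>h'\<close> lies in \<open>f j\<close>, its own cell is
        \<open>f j\<close>.\<close>
      using fA[OF that] cell_eqI[OF m f h'] by simp
    moreover have "h' \<in> H M m"
      using Choice_subset_H[OF m f] h' by blast
    ultimately show ?thesis by blast
  qed
  then have "\<exists>h' \<in> H M m. holds M m h' (Conjs (map (\<lambda>(j, A). Stit j A) jAs))"
    if "holds M m h (Conjs (map (\<lambda>(j, A). Dia (Stit j A)) jAs))"
    using that ne by (simp add: holds_Conjs case_prod_beta)
  then show ?thesis by auto
qed

lemma axiom_holds:
  assumes "axiom_inst A" and m: "m \<in> Tree M" and h: "h \<in> H M m"
  shows "holds M m h A"
  using assms(1)
proof cases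
  case A0
  then show ?thesis by (rule tautology_holds)
next
  case A1_Box
  then show ?thesis using h by (rule S5_axiom_Box_holds)
next
  case (A1_Stit j)
  then show ?thesis using m h by (rule S5_axiom_Stit_holds)
next
  case (A2 B j)
  then show ?thesis using cell_subset_H[OF m h] by auto
next
  case (A3 jAs)
  then show ?thesis using independence_holds[OF A3(2,3) m h] by (simp only:)
next
  case (A4 s B C t)
  then show ?thesis using evidence_App[OF m, of B C s t] by auto
next
  case (A5 t B)
  have "holds M m h (Just (Bang t) (Just t B) \<^bold>\<and> Know B)" if prem: "holds M m h (Just t B)"
  proof -
    have B: "B \<in> Evid M m t" and Re: "\<And>m' h'. (m, m') \<in> Re M \<Longrightarrow> h' \<in> H M m' \<Longrightarrow> holds M m' h' B"
      using prem by auto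
    \<comment> \<open>Evidence for \<open>B\<close> persists along \<open>Re\<close>, and
      transitivity of \<open>Re\<close> carries the truth of \<open>B\<close> to all successors of
      \<open>m'\<close>.\<close>
    have "holds M m' h' (Just t B)" if m': "(m, m') \<in> Re M" for m' h'
      using subsetD[OF evidence_monotone[OF m'] B] Re[OF Re_trans[OF m']] by simp
    moreover have "Just t B \<in> Evid M m (Bang t)"
      using B by (rule evidence_Bang[OF m])
    ultimately have "holds M m h (Just (Bang t) (Just t B))"
      \<comment> \<open>A single unfolding keeps the inner \<open>Just t B\<close> intact, so that
        it matches the fact just proved.\<close>
      by (subst holds.simps(6)) blast
    moreover have "holds M m h (Know B)"
      using Re[OF subsetD[OF R_subset_Re]] by simp
    ultimately show ?thesis
      by (simp only: holds.simps(2))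
  qed
  then show ?thesis
    unfolding A5 holds_Imp by (rule impI)
next
  case (A6 s B t)
  then show ?thesis using evidence_Sum[OF m, of s t] by auto
next
  case A7
  then show ?thesis using m h by (rule S4_axiom_Know_holds)
next
  case (A8 B)
  \<comment> \<open>The truth of \<open>Know B\<close> does not depend on the history and already
    ranges over all histories through each accessible moment, which absorbs both boxes.\<close>
  have "holds M m h' (Know (Box B))" if "holds M m h (Know B)" for h'
    using that R_trans by (simp; blast)
  with A8 show ?thesis by auto
next
  case (A9 t)
  have "holds M m h (Know (Box (Proven t)))" if prem: "holds M m h (Box (Proven t))"
  proof -
    have "t \<in> (\<Inter>h' \<in> H M m. Act M m h')"
      using prem by simp
    \<comment> \<open>Settled proofs are transparent along \<open>Re\<close>, hence along the
      smaller relation \<open>R\<close>.\<close>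
    then have "t \<in> (\<Inter>h' \<in> H M m'. Act M m' h')" if "(m, m') \<in> R M" for m'
      using subsetD[OF R_subset_Re that] presented_proofs_epistemically_transparent by blast
    then show ?thesis by simp
  qed
  then show ?thesis
    unfolding A9 holds_Imp by (rule impI)
qed

end

section \<open>Validity and its preservation by the rules\<close>

lemma validI:
  assumes "\<And>(M :: ('m, 'ag) jstit) m h. normal_jstit_model M \<Longrightarrow> m \<in> Tree M \<Longrightarrow> h \<in> H M m \<Longrightarrow>
             holds M m h A"
  shows "valid TYPE('m) (A :: 'ag :: finite form)"
  using assms by (auto simp: valid_def MH_def)

lemma validD:
  assumes "valid TYPE('m) (A :: 'ag :: finite form)"
    and "normal_jstit_model (M :: ('m, 'ag) jstit)" "m \<in> Tree M" "h \<in> H M m"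
  shows "holds M m h A"
  using assms by (auto simp: valid_def MH_def)

lemma axiom_valid: "axiom_inst A \<Longrightarrow> valid TYPE('m) (A :: 'ag :: finite form)"
  by (blast intro: validI jstit_model.axiom_holds normal_jstit_model.axioms(1))

lemma R4_valid:
  assumes ts: "ts \<noteq> []"
    and prem: "valid TYPE('m) (Know A \<^bold>\<longrightarrow> Disjs (map (\<lambda>t. \<^bold>\<not> Box (Proven t)) ts))"
  shows "valid TYPE('m) (Know A \<^bold>\<longrightarrow> Disjs (map (\<lambda>t. \<^bold>\<not> Proven t) ts) :: 'ag :: finite form)"
proof (rule validI)
  fix M :: "('m, 'ag) jstit" and m h
  assume M: "normal_jstit_model M" and m: "m \<in> Tree M" and h: "h \<in> H M m"
  interpret normal_jstit_model M by (fact M)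
  have "\<exists>t \<in> set ts. t \<notin> Act M m h" if K: "holds M m h (Know A)"
  proof -
    obtain m' where m': "(m, m') \<in> R M" "h \<in> H M m'"
      and Act: "\<And>h'. h' \<in> H M m' \<Longrightarrow> Act M m h \<subseteq> Act M m' h'"
      using proven_becomes_settled[OF m h] by blast
    have "holds M m' h (Know A)"
      using K R_trans[OF m'(1)] by simp
    \<comment> \<open>The premise is used at \<open>(m', h)\<close>. It yields a \<open>t\<close>
      missing from some history through \<open>m'\<close>; by \<open>Act\<close> that
      \<open>t\<close> cannot be presented at \<open>(m, h)\<close>.\<close>
    then have "\<exists>t \<in> set ts. \<exists>h' \<in> H M m'. t \<notin> Act M m' h'"
      using validD[OF prem M _ m'(2)] R_in_Tree[OF m'(1)] ts by (auto simp: holds_Disjs)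
    then show ?thesis
      using Act by blast
  qed
  then show "holds M m h (Know A \<^bold>\<longrightarrow> Disjs (map (\<lambda>t. \<^bold>\<not> Proven t) ts))"
    using ts by (auto simp: holds_Disjs)
qed

lemma rule_valid:
  assumes "rule_app As B" and prems: "\<forall>A \<in> set As. valid TYPE('m) A"
  shows "valid TYPE('m) (B :: 'ag :: finite form)"
  using assms(1)
proof cases
  case (R1 A)
  show ?thesis
  proof (rule validI)
    fix M :: "('m, 'ag) jstit" and m h
    assume M: "normal_jstit_model M" "m \<in> Tree M" "h \<in> H M m"
    have "holds M m h A"
      using prems R1 by (intro validD[OF _ M]) simp
    moreover have "holds M m h (A \<^bold>\<longrightarrow> B)"
      using prems R1 by (intro validD[OF _ M]) simp
    ultimately show "holds M m h B" by simp
  qed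
next
  case (R2 A)
  show ?thesis
  proof (rule validI)
    fix M :: "('m, 'ag) jstit" and m h
    assume M: "normal_jstit_model M"
    interpret normal_jstit_model M by (fact M)
    have "valid TYPE('m) A"
      using prems R2 by simp
    from validD[OF this M] show "holds M m h B"
      unfolding R2(2) using R_in_Tree by auto
  qed
next
  case (R3 A c)
  show ?thesis
  proof (rule validI)
    fix M :: "('m, 'ag) jstit" and m h
    assume M: "normal_jstit_model M" and m: "m \<in> Tree M"
    interpret normal_jstit_model M by (fact M)
    show "holds M m h B"
      \<comment> \<open>Normality supplies the evidence at \<open>m\<close>; the truth of the axiom
        instance at every \<open>Re\<close>-successor comes from the first half of the
        theorem.\<close>
      using normal[OF m R3(3)] axiom_holds[OF R3(3)] Re_in_Tree unfolding R3(2) by auto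
  qed
next
  case (R4 ts A)
  then show ?thesis
    using R4_valid[of ts A] prems by simp
qed

theorem theorem1:
  shows "(\<forall>A :: 'ag :: finite form. axiom_inst A \<longrightarrow> valid TYPE('m) A) \<and>
         (\<forall>As (B :: 'ag form). rule_app As B \<longrightarrow> (\<forall>A \<in> set As. valid TYPE('m) A) \<longrightarrow>
            valid TYPE('m) B)"
  using axiom_valid rule_valid by blast

end
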